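(* Let $K\subset\mathbb{R}$ be an interval with interior $K^0$, let $\varphi:K\to\mathbb{R}$ be continuous with $0\le\varphi\le\frac{\pi}{2}$, and let $a,b\in K^0$ with $a<a+e^{i\varphi}(b-a)$ and $[a,a+e^{i\varphi}(b-a)]\subset K$. Let $f:K\to(0,\infty)$ be twice differentiable on $K^0$ with $f''$ integrable on $[a,a+e^{i\varphi}(b-a)]$. Let $q\in\mathbb{R}$ with $q\ge1$. If $|f''|^{q}$ is a quasi $\varphi$-convex function on $K^0$, then $$\left|\frac{1}{e^{i\varphi}(b-a)}\int_a^{a+e^{i\varphi}(b-a)}f(x)\,dx-\frac{f(a)+f(a+e^{i\varphi}(b-a))}{2}\right|\le\frac{e^{2i\varphi}(b-a)^2}{12}\left[\max\left\{|f''(a)|^{q},|f''(b)|^{q}\right\}\right]^{\frac1q}.$$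
   Context: Here $i$ is the imaginary unit. In an expression $u+te^{i\varphi}(v-u)$ the argument of $\varphi$ is suppressed and $\varphi$ is read as its value at the base point $u$; thus $a+e^{i\varphi}(b-a)$ uses $\varphi=\varphi(a)$. Since $a+e^{i\varphi}(b-a)$ is an endpoint of a real interval, it is understood to be a real number. A set $S$ is $\varphi$-convex if $u+te^{i\varphi}(v-u)\in S$ for all $u,v\in S$ and $t\in[0,1]$. A real-valued function $g$ on a $\varphi$-convex set $S$ is quasi $\varphi$-convex if $g(u+te^{i\varphi}(v-u))\le\max\{g(u),g(v)\}$ for all $u,v\in S$, $t\in[0,1]$. Saying that $g$ is quasi $\varphi$-convex on a set includes that the set is $\varphi$-convex. *)

theory Defs
  imports "HOL-Analysis.Analysis" "HOL-Library.Complex_Order"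
begin

(* Complex_Order orders the complex numbers by: x \<le> y iff Re x \<le> Re y and Im x = Im y.
   An inequality between complex expressions thus includes that their difference is real. *)

definition phi_point :: "(real \<Rightarrow> real) \<Rightarrow> real \<Rightarrow> real \<Rightarrow> real \<Rightarrow> complex" where
  "phi_point \<phi> u v t =
     complex_of_real u
     + complex_of_real t * exp (\<i> * complex_of_real (\<phi> u)) * complex_of_real (v - u)"

(* The points u + t e^{i phi(u)} (v - u) are complex in general; membership in the real set S
   means membership in its copy inside the complex plane, so it includes being real. *)
definition phi_convex :: "(real \<Rightarrow> real) \<Rightarrow> real set \<Rightarrow> bool" where
  "phi_convex \<phi> S \<longleftrightarrow>
     (\<forall>u\<in>S. \<forall>v\<in>S. \<forall>t\<in>{0..1}. phi_point \<phi> u v t \<in> complex_of_real ` S)"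

(* By the first conjunct all the points at which g is evaluated are real,
   so Re only converts the type. *)
definition quasi_phi_convex_on :: "(real \<Rightarrow> real) \<Rightarrow> real set \<Rightarrow> (real \<Rightarrow> real) \<Rightarrow> bool" where
  "quasi_phi_convex_on \<phi> S g \<longleftrightarrow>
     phi_convex \<phi> S \<and>
     (\<forall>u\<in>S. \<forall>v\<in>S. \<forall>t\<in>{0..1}. g (Re (phi_point \<phi> u v t)) \<le> max (g u) (g v))"

end

(* Since c is real and c > a, the number e^{i phi(a)} (b - a) is a positive real; with
   0 <= phi(a) <= pi/2 this forces phi(a) = 0, so c = b and the hypothesis on |f''|^q becomes
   the bound |f''| <= M on [a, b].  What remains is the error bound of the trapezoidal rule,
   which is obtained by two comparisons of derivatives rather than by integrating by parts:
   for H(x) = f(x) - f(a) - (x - a) f'(x) one has |H'(x)| <= M (x - a), and the integral over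
   [a, x] minus its trapezoidal value has derivative H(x) / 2. *)

theory Submission
  imports Defs
begin

lemma trapezoid_error_le:
  fixes f f' f'' :: "real \<Rightarrow> real"
  assumes "a < b"
    and f': "\<And>x. x \<in> {a..b} \<Longrightarrow> (f has_real_derivative f' x) (at x)"
    and f'': "\<And>x. x \<in> {a..b} \<Longrightarrow> (f' has_real_derivative f'' x) (at x)"
    and bound: "\<And>x. x \<in> {a..b} \<Longrightarrow> \<bar>f'' x\<bar> \<le> M"
  shows "\<bar>1 / (b - a) * integral {a..b} f - (f a + f b) / 2\<bar> \<le> (b - a)\<^sup>2 / 12 * M"
proof -
  have cont_f: "continuous_on {a..b} f"
    by (rule DERIV_continuous_on[OF has_field_derivative_at_within[OF f']])
  have cont_f': "continuous_on {a..b} f'"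
    by (rule DERIV_continuous_on[OF has_field_derivative_at_within[OF f'']])
  define H where "H x = f x - f a - (x - a) * f' x" for x
  define G where "G x = integral {a..x} f - (x - a) * (f a + f x) / 2" for x
  \<comment> \<open>The two f' terms cancel in the derivative of \<open>H\<close>, leaving -(y - a)
    f''(y), of modulus at most M (y - a). The comparison rule needs a nondegenerate interval, hence
    the case split; at x = a both sides vanish.\<close>
  have H_le: "\<bar>H x\<bar> \<le> M * (x - a)\<^sup>2 / 2" if x: "x \<in> {a..b}" for x
  proof (cases "a < x")
    case True
    have "norm (H x - H a) \<le> M * (x - a)\<^sup>2 / 2 - M * (a - a)\<^sup>2 / 2"
    proof (rule differentiable_bound_general
        [where f' = "\<lambda>y. - ((y - a) * f'' y)" and \<phi>' = "\<lambda>y. M * (y - a)", OF True])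
      show "continuous_on {a..x} H"
        unfolding H_def using x
        by (intro continuous_intros continuous_on_subset[OF cont_f] continuous_on_subset[OF cont_f'])
          auto
      show "continuous_on {a..x} (\<lambda>y. M * (y - a)\<^sup>2 / 2)"
        by (intro continuous_intros) auto
      fix y assume y: "a < y" "y < x"
      then have y_in: "y \<in> {a..b}" using x by auto
      show "(H has_vector_derivative - ((y - a) * f'' y)) (at y)"
        unfolding H_def has_real_derivative_iff_has_vector_derivative[symmetric]
        by (auto intro!: derivative_eq_intros f'[OF y_in] f''[OF y_in])
      show "((\<lambda>y. M * (y - a)\<^sup>2 / 2) has_vector_derivative M * (y - a)) (at y)"
        unfolding has_real_derivative_iff_has_vector_derivative[symmetric]
        by (auto intro!: derivative_eq_intros)
      show "norm (- ((y - a) * f'' y)) \<le> M * (y - a)"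
        using y bound[OF y_in] by (simp add: abs_mult mult.commute mult_left_mono)
    qed
    then show ?thesis by (simp add: H_def)
  next
    case False
    then show ?thesis using x by (simp add: H_def)
  qed
  \<comment> \<open>The comparison function is the antiderivative, vanishing at a, of M (y - a)^2 /
    4, which is half the bound on |H|. The constant is 12 = 4 * 3.\<close>
  have "norm (G b - G a) \<le> M * (b - a) ^ 3 / 12 - M * (a - a) ^ 3 / 12"
  proof (rule differentiable_bound_general
      [where f' = "\<lambda>y. H y / 2" and \<phi>' = "\<lambda>y. M * (y - a)\<^sup>2 / 4", OF \<open>a < b\<close>])
    show "continuous_on {a..b} G"
      unfolding G_def
      by (intro continuous_intros cont_f indefinite_integral_continuous_1
          integrable_continuous_interval) auto
    show "continuous_on {a..b} (\<lambda>y. M * (y - a) ^ 3 / 12)"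
      by (intro continuous_intros) auto
    fix y assume y: "a < y" "y < b"
    then have y_in: "y \<in> {a..b}" by auto
    have "((\<lambda>x. integral {a..x} f) has_real_derivative f y) (at y within {a..b})"
      by (rule integral_has_real_derivative[OF cont_f y_in])
    \<comment> \<open>The derivative within the closed interval is two-sided because y is an
      interior point.\<close>
    then have "((\<lambda>x. integral {a..x} f) has_real_derivative f y) (at y)"
      by (simp only: at_within_Icc_at[OF y])
    then show "(G has_vector_derivative H y / 2) (at y)"
      unfolding G_def H_def has_real_derivative_iff_has_vector_derivative[symmetric]
      by (auto intro!: derivative_eq_intros f'[OF y_in] simp: field_simps)
    show "((\<lambda>y. M * (y - a) ^ 3 / 12) has_vector_derivative M * (y - a)\<^sup>2 / 4) (at y)"
      unfolding has_real_derivative_iff_has_vector_derivative[symmetric]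
      by (auto intro!: derivative_eq_intros)
    show "norm (H y / 2) \<le> M * (y - a)\<^sup>2 / 4"
      using H_le[OF y_in] by simp
  qed
  \<comment> \<open>\<open>G\<close> vanishes at a, and G(b) is the error before normalisation;
    dividing by b - a turns the cube into a square.\<close>
  then have "\<bar>G b\<bar> \<le> M * (b - a) ^ 3 / 12" by (simp add: G_def)
  then have "\<bar>G b\<bar> / (b - a) \<le> (b - a)\<^sup>2 / 12 * M"
    using \<open>a < b\<close> by (simp add: divide_simps power2_eq_square power3_eq_cube mult_ac)
  moreover have "1 / (b - a) * integral {a..b} f - (f a + f b) / 2 = G b / (b - a)"
    using \<open>a < b\<close> by (simp add: G_def field_simps)
  ultimately show ?thesis
    using \<open>a < b\<close> by (simp only: abs_divide abs_of_pos diff_gt_0_iff_gt)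
qed

text \<open>Compare real and imaginary parts. The real part s > 0 rules out r = 0, so the vanishing
  imaginary part forces sin \<theta> = 0, and 0 is the only zero of the sine on [0, pi/2].\<close>

lemma exp_i_eq_1:
  fixes \<theta> r s :: real
  assumes "0 \<le> \<theta>" "\<theta> \<le> pi / 2" "0 < s"
    and eq: "complex_of_real s = exp (\<i> * complex_of_real \<theta>) * complex_of_real r"
  shows "exp (\<i> * complex_of_real \<theta>) = 1"
proof -
  have e: "exp (\<i> * complex_of_real \<theta>) = Complex (cos \<theta>) (sin \<theta>)"
    by (simp add: cis_conv_exp[symmetric] cis.code)
  have "sin \<theta> * r = 0" "cos \<theta> * r = s"
    using eq by (simp_all add: e complex_eq_iff)
  then have "sin \<theta> = 0" using \<open>0 < s\<close> by auto
  then have "\<theta> = 0" using assms(1,2) sin_gt_zero[of \<theta>] pi_gt_zero by force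
  then show ?thesis by simp
qed

theorem theorem12:
  fixes K :: "real set" and \<phi> f :: "real \<Rightarrow> real" and a b c q :: real
  assumes "is_interval K"
    and "continuous_on K \<phi>"
    and "\<And>x. x \<in> K \<Longrightarrow> 0 \<le> \<phi> x \<and> \<phi> x \<le> pi / 2"
    and "a \<in> interior K" and "b \<in> interior K"
    and "complex_of_real c =
           complex_of_real a + exp (\<i> * complex_of_real (\<phi> a)) * complex_of_real (b - a)"
    and "a < c" and "{a..c} \<subseteq> K"
    and "\<And>x. x \<in> K \<Longrightarrow> 0 < f x"
    and "\<And>x. x \<in> interior K \<Longrightarrow> f differentiable (at x)"
    and "\<And>x. x \<in> interior K \<Longrightarrow> deriv f differentiable (at x)"
    and "deriv (deriv f) absolutely_integrable_on {a..c}"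
    and "1 \<le> q"
    and "quasi_phi_convex_on \<phi> (interior K) (\<lambda>x. \<bar>deriv (deriv f) x\<bar> powr q)"
  shows "complex_of_real (cmod
           (1 / (exp (\<i> * complex_of_real (\<phi> a)) * complex_of_real (b - a))
              * complex_of_real (integral {a..c} f)
            - complex_of_real ((f a + f c) / 2)))
         \<le> exp (2 * \<i> * complex_of_real (\<phi> a)) * (complex_of_real (b - a))\<^sup>2 / 12
            * complex_of_real
                ((max (\<bar>deriv (deriv f) a\<bar> powr q) (\<bar>deriv (deriv f) b\<bar> powr q)) powr (1 / q))"
proof -
  have "a \<in> K" using assms(4) interior_subset by blast
  have "complex_of_real (c - a) = exp (\<i> * complex_of_real (\<phi> a)) * complex_of_real (b - a)"
    using assms(6) by simp
  then have e: "exp (\<i> * complex_of_real (\<phi> a)) = 1"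
    using assms(3)[OF \<open>a \<in> K\<close>] \<open>a < c\<close> exp_i_eq_1[of "\<phi> a" "c - a" "b - a"] by simp
  have e2: "exp (2 * \<i> * complex_of_real (\<phi> a)) = 1"
    using e exp_double[of "\<i> * complex_of_real (\<phi> a)"] by (simp add: mult.assoc)
  have "complex_of_real c = complex_of_real b" using assms(6) by (simp add: e)
  then have "c = b" by (simp only: of_real_eq_iff)
  with \<open>a < c\<close> have "a < b" by simp
  define M where
    "M = max (\<bar>deriv (deriv f) a\<bar> powr q) (\<bar>deriv (deriv f) b\<bar> powr q) powr (1 / q)"
  have "is_interval (interior K)"
    using assms(1) by (simp add: is_interval_convex_1 convex_interior)
  \<comment> \<open>Differentiability and quasi-convexity are available on the interior only. It is
    again an interval, so it contains all of [a, b] along with the endpoints.\<close>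
  then have sub: "x \<in> interior K" if "x \<in> {a..b}" for x
    using that mem_is_interval_1_I[OF _ assms(4,5)] by simp
  have bound: "\<bar>deriv (deriv f) x\<bar> \<le> M" if x: "x \<in> {a..b}" for x
  proof -
    \<comment> \<open>With the exponential equal to 1, \<open>phi_point\<close> is the segment from
      a to b, and this \<open>t\<close> is the parameter of x on it.\<close>
    define t where "t = (x - a) / (b - a)"
    have t: "t \<in> {0..1}" "t * (b - a) = x - a"
      using x \<open>a < b\<close> by (auto simp: t_def)
    have "Re (phi_point \<phi> a b t) = x"
      using t(2) by (simp add: phi_point_def e)
    then have "\<bar>deriv (deriv f) x\<bar> powr q
        \<le> max (\<bar>deriv (deriv f) a\<bar> powr q) (\<bar>deriv (deriv f) b\<bar> powr q)"
      using assms(14,4,5) t(1) unfolding quasi_phi_convex_on_def by metis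
    \<comment> \<open>Taking q-th roots is monotone on nonnegative reals. It recovers |f''(x)| even
      where this is 0, since \<open>0 powr q\<close> is 0.\<close>
    then have "(\<bar>deriv (deriv f) x\<bar> powr q) powr (1 / q) \<le> M"
      unfolding M_def using \<open>1 \<le> q\<close> by (intro powr_mono2) auto
    then show ?thesis using \<open>1 \<le> q\<close> by (simp add: powr_powr)
  qed
  have "\<bar>1 / (b - a) * integral {a..b} f - (f a + f b) / 2\<bar> \<le> (b - a)\<^sup>2 / 12 * M"
  proof (rule trapezoid_error_le[OF \<open>a < b\<close> _ _ bound])
    fix x assume "x \<in> {a..b}"
    then have "x \<in> interior K" by (rule sub)
    then show "(f has_real_derivative deriv f x) (at x)"
      and "(deriv f has_real_derivative deriv (deriv f) x) (at x)"
      using assms(10,11) by (simp_all add: DERIV_deriv_iff_real_differentiable)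
  qed
  \<comment> \<open>Both sides are embedded reals, so their imaginary parts agree and the complex
    order reduces to the real one.\<close>
  then have "complex_of_real (cmod (complex_of_real
        (1 / (b - a) * integral {a..b} f - (f a + f b) / 2)))
      \<le> complex_of_real ((b - a)\<^sup>2 / 12 * M)"
    by (simp only: norm_of_real less_eq_complex_def Re_complex_of_real Im_complex_of_real real_norm_def simp_thms)
  then show ?thesis
    unfolding e e2 \<open>c = b\<close> M_def[symmetric] by simp
qed

end
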